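(* There exists a $2$-variable weighted shift $W_{(\alpha,\beta)}\equiv(T_1,T_2)$ such that $W_{(\alpha,\beta)}=(T_1,T_2)$, $W_{(\alpha,\beta)}^{(2,1)}=(T_1^2,T_2)$ and $W_{(\alpha,\beta)}^{(1,2)}=(T_1,T_2^2)$ are all spherically quasinormal, but $W_{(\alpha,\beta)}$ is not (jointly) quasinormal.
   Context: Let $\mathbb{Z}_+=\{0,1,2,\dots\}$, let $\{e_{\mathbf{k}}\}_{\mathbf{k}\in\mathbb{Z}_+^2}$ be the canonical orthonormal basis of $\ell^2(\mathbb{Z}_+^2)$, and let $\varepsilon_1=(1,0)$, $\varepsilon_2=(0,1)$. Given bounded families of positive real numbers $\alpha=\{\alpha_{\mathbf{k}}\}$, $\beta=\{\beta_{\mathbf{k}}\}$ ($\mathbf{k}\in\mathbb{Z}_+^2$), the $2$-variable weighted shift $W_{(\alpha,\beta)}\equiv(T_1,T_2)$ is the pair of bounded operators on $\ell^2(\mathbb{Z}_+^2)$ given by $T_1e_{\mathbf{k}}=\alpha_{\mathbf{k}}e_{\mathbf{k}+\varepsilon_1}$ and $T_2e_{\mathbf{k}}=\beta_{\mathbf{k}}e_{\mathbf{k}+\varepsilon_2}$. All $2$-variable weighted shifts are assumed commuting: $T_1T_2=T_2T_1$, i.e. $\beta_{\mathbf{k}+\varepsilon_1}\alpha_{\mathbf{k}}=\alpha_{\mathbf{k}+\varepsilon_2}\beta_{\mathbf{k}}$ for all $\mathbf{k}$. A commuting pair $(S_1,S_2)$ of bounded operators is spherically quasinormal if each of $S_1,S_2$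 commutes with $S_1^*S_1+S_2^*S_2$, and (jointly) quasinormal if $S_i$ commutes with $S_j^*S_j$ for all $i,j\in\{1,2\}$. *)

theory Defs
  imports "HOL-Analysis.Analysis"
begin

section \<open>The complex Hilbert space of square-summable families\<close>

typedef 'a ell2 = "{f :: 'a \<Rightarrow> complex. (\<lambda>k. (cmod (f k))\<^sup>2) summable_on UNIV}"
  morphisms coord Abs_ell2
  by (rule exI[of _ "\<lambda>_. 0"]) simp

setup_lifting type_definition_ell2

lemma summable_coord: "(\<lambda>k. (cmod (coord x k))\<^sup>2) summable_on UNIV"
  using coord[of x] by simp

lemma square_summable_mult_cnj:
  fixes f g :: "'a \<Rightarrow> complex"
  assumes "(\<lambda>k. (cmod (f k))\<^sup>2) summable_on UNIV" "(\<lambda>k. (cmod (g k))\<^sup>2) summable_on UNIV"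
  shows "(\<lambda>k. f k * cnj (g k)) summable_on UNIV"
proof -
  have "(\<lambda>k. norm (f k * cnj (g k))) summable_on UNIV"
  proof (rule summable_on_comparison_test)
    show "(\<lambda>k. (cmod (f k))\<^sup>2 + (cmod (g k))\<^sup>2) summable_on UNIV"
      by (intro summable_on_add assms)
    show "norm (f k * cnj (g k)) \<le> (cmod (f k))\<^sup>2 + (cmod (g k))\<^sup>2" for k
    proof -
      have "cmod (f k) * cmod (g k) \<le> 2 * cmod (f k) * cmod (g k)"
        by simp
      also have "\<dots> \<le> (cmod (f k))\<^sup>2 + (cmod (g k))\<^sup>2"
        by (rule sum_squares_bound)
      finally show ?thesis by (simp add: norm_mult)
    qed
  qed auto
  then show ?thesis by (rule abs_summable_summable)
qed

lemma square_summable_add: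
  fixes f g :: "'a \<Rightarrow> complex"
  assumes "(\<lambda>k. (cmod (f k))\<^sup>2) summable_on UNIV" "(\<lambda>k. (cmod (g k))\<^sup>2) summable_on UNIV"
  shows "(\<lambda>k. (cmod (f k + g k))\<^sup>2) summable_on UNIV"
proof (rule summable_on_comparison_test)
  show "(\<lambda>k. 2 * (cmod (f k))\<^sup>2 + 2 * (cmod (g k))\<^sup>2) summable_on UNIV"
    by (intro summable_on_add summable_on_cmult_right assms)
  show "(cmod (f k + g k))\<^sup>2 \<le> 2 * (cmod (f k))\<^sup>2 + 2 * (cmod (g k))\<^sup>2" for k
  proof -
    have "(cmod (f k + g k))\<^sup>2 \<le> (cmod (f k) + cmod (g k))\<^sup>2"
      by (intro power_mono norm_triangle_ineq) auto
    also have "\<dots> = (cmod (f k))\<^sup>2 + (cmod (g k))\<^sup>2 + 2 * cmod (f k) * cmod (g k)"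
      by (rule power2_sum)
    also have "\<dots> \<le> 2 * (cmod (f k))\<^sup>2 + 2 * (cmod (g k))\<^sup>2"
      using sum_squares_bound[of "cmod (f k)" "cmod (g k)"] by simp
    finally show ?thesis .
  qed
qed auto

lemma square_summable_cmult:
  fixes f :: "'a \<Rightarrow> complex"
  assumes "(\<lambda>k. (cmod (f k))\<^sup>2) summable_on UNIV"
  shows "(\<lambda>k. (cmod (c * f k))\<^sup>2) summable_on UNIV"
  using summable_on_cmult_right[OF assms, of "(cmod c)\<^sup>2"]
  by (simp add: norm_mult power_mult_distrib)

lift_definition scaleC :: "complex \<Rightarrow> 'a ell2 \<Rightarrow> 'a ell2" is "\<lambda>c f k. c * f k"
  by (rule square_summable_cmult)

definition cinner :: "'a ell2 \<Rightarrow> 'a ell2 \<Rightarrow> complex" where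
  "cinner x y = (\<Sum>\<^sub>\<infinity>k. coord x k * cnj (coord y k))"

instantiation ell2 :: (type) real_inner
begin

lift_definition zero_ell2 :: "'a ell2" is "\<lambda>_. 0" by simp

lift_definition plus_ell2 :: "'a ell2 \<Rightarrow> 'a ell2 \<Rightarrow> 'a ell2" is "\<lambda>f g k. f k + g k"
  by (rule square_summable_add)

lift_definition uminus_ell2 :: "'a ell2 \<Rightarrow> 'a ell2" is "\<lambda>f k. - f k" by simp

definition minus_ell2_def:
  "x - y = x + - (y :: 'a ell2)"

definition scaleR_ell2_def:
  "scaleR r x = scaleC (complex_of_real r) x"

definition inner_ell2_def:
  "inner x y = Re (cinner x y)"

definition norm_ell2_def:
  "norm x = sqrt (\<Sum>\<^sub>\<infinity>k. (cmod (coord x k))\<^sup>2)"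

definition sgn_ell2_def:
  "sgn x = scaleR (inverse (norm x)) (x :: 'a ell2)"

definition dist_ell2_def:
  "dist x y = norm (x - y :: 'a ell2)"

definition uniformity_ell2_def:
  "uniformity = (INF e\<in>{0 <..}. principal {(x :: 'a ell2, y). dist x y < e})"

definition open_ell2_def:
  "open (U :: 'a ell2 set) \<longleftrightarrow> (\<forall>x\<in>U. eventually (\<lambda>(x', y). x' = x \<longrightarrow> y \<in> U) uniformity)"

instance
proof
  fix x y z :: "'a ell2" and r s :: real
  note [simp] = scaleR_ell2_def
  have sm: "(\<lambda>k. coord u k * cnj (coord v k)) summable_on UNIV" for u v :: "'a ell2"
    by (intro square_summable_mult_cnj summable_coord)
  have inner_self: "inner x x = (\<Sum>\<^sub>\<infinity>k. (cmod (coord x k))\<^sup>2)"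
    unfolding inner_ell2_def cinner_def
    by (subst infsum_Re[OF sm, symmetric]) (simp add: complex_norm_square[symmetric] cmod_power2 power2_eq_square)
  show "x + y + z = x + (y + z)" by transfer (simp add: add.assoc)
  show "x + y = y + x" by transfer (simp add: add.commute)
  show "0 + x = x" by transfer simp
  show "- x + x = 0" by transfer simp
  show "x - y = x + - y" by (rule minus_ell2_def)
  show "r *\<^sub>R (x + y) = r *\<^sub>R x + r *\<^sub>R y" by simp (transfer, simp add: ring_distribs)
  show "(r + s) *\<^sub>R x = r *\<^sub>R x + s *\<^sub>R x" by simp (transfer, simp add: ring_distribs)
  show "r *\<^sub>R s *\<^sub>R x = (r * s) *\<^sub>R x" by simp (transfer, simp add: mult.assoc)
  show "1 *\<^sub>R x = x" by simp (transfer, simp)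
  show "sgn x = inverse (norm x) *\<^sub>R x" by (rule sgn_ell2_def)
  show "dist x y = norm (x - y)" by (rule dist_ell2_def)
  show "uniformity = (INF e\<in>{0<..}. principal {(x :: 'a ell2, y). dist x y < e})"
    by (rule uniformity_ell2_def)
  show "open U \<longleftrightarrow> (\<forall>x\<in>U. \<forall>\<^sub>F (x', y) in uniformity. x' = x \<longrightarrow> y \<in> U)" for U :: "'a ell2 set"
    by (rule open_ell2_def)
  show "inner x y = inner y x"
  proof -
    have "cinner y x = cnj (cinner x y)"
      unfolding cinner_def infsum_cnj[symmetric] by (simp add: mult.commute)
    then show ?thesis by (simp add: inner_ell2_def)
  qed
  show "inner (x + y) z = inner x z + inner y z"
    unfolding inner_ell2_def cinner_def
    by (simp add: plus_ell2.rep_eq ring_distribs infsum_add[OF sm sm])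
  show "inner (r *\<^sub>R x) y = r * inner x y"
    unfolding inner_ell2_def cinner_def
    by (simp add: scaleC.rep_eq mult.assoc infsum_cmult_right')
  show "0 \<le> inner x x" unfolding inner_self by (intro infsum_nonneg) simp
  show "norm x = sqrt (inner x x)" unfolding inner_self by (rule norm_ell2_def)
  show "inner x x = 0 \<longleftrightarrow> x = 0"
  proof
    assume "inner x x = 0"
    then have "(cmod (coord x k))\<^sup>2 = 0" for k
      unfolding inner_self
      using nonneg_infsum_le_0D[OF _ summable_coord[of x], of k] by simp
    then have "coord x = coord 0" by (simp add: fun_eq_iff zero_ell2.rep_eq)
    then show "x = 0" by (simp add: coord_inject)
  next
    assume "x = 0"
    then show "inner x x = 0" unfolding inner_self by (simp add: zero_ell2.rep_eq)
  qed
qed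

end

lift_definition basis_vec :: "'a \<Rightarrow> 'a ell2" is "\<lambda>k j. if j = k then 1 else 0"
proof -
  fix k :: 'a
  have "(\<lambda>j. (cmod (if j = k then 1 else 0))\<^sup>2) summable_on UNIV
      \<longleftrightarrow> (\<lambda>j. (cmod (if j = k then 1 else 0))\<^sup>2) summable_on {k}"
    by (rule summable_on_cong_neutral) auto
  then show "(\<lambda>j. (cmod (if j = k then 1 else 0))\<^sup>2) summable_on UNIV"
    by simp
qed


section \<open>Bounded operators and adjoints\<close>

definition bounded_operator :: "('a ell2 \<Rightarrow> 'a ell2) \<Rightarrow> bool" where
  "bounded_operator S \<longleftrightarrow> bounded_linear S \<and> (\<forall>c x. S (scaleC c x) = scaleC c (S x))"

text \<open>
  By the Riesz representation theorem the description below is proper for every bounded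
  operator.  The constant \<open>adjoint\<close> of the library is not used, since it refers to the real
  inner product.
\<close>

definition cadjoint :: "('a ell2 \<Rightarrow> 'a ell2) \<Rightarrow> 'a ell2 \<Rightarrow> 'a ell2" where
  "cadjoint S = (THE S'. \<forall>x y. cinner (S x) y = cinner x (S' y))"

lemma cinner_basis_vec_left: "cinner (basis_vec k) y = cnj (coord y k)"
proof -
  have "cinner (basis_vec k) y = (\<Sum>\<^sub>\<infinity>j\<in>{k}. cnj (coord y j))"
    unfolding cinner_def by (rule infsum_cong_neutral) (auto simp: basis_vec.rep_eq)
  then show ?thesis by simp
qed

lemma cadjoint_eqI:
  assumes "\<And>x y. cinner (S x) y = cinner x (S' y)"
  shows "cadjoint S = S'"
  unfolding cadjoint_def
proof (rule the_equality)
  show "\<forall>x y. cinner (S x) y = cinner x (S' y)" using assms by blast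
  fix R assume R: "\<forall>x y. cinner (S x) y = cinner x (R y)"
  show "R = S'"
  proof
    fix y
    have "cinner (basis_vec k) (R y) = cinner (basis_vec k) (S' y)" for k
      using R assms by metis
    then have "coord (R y) = coord (S' y)"
      by (simp add: cinner_basis_vec_left fun_eq_iff)
    then show "R y = S' y" by (simp add: coord_inject)
  qed
qed

definition commuting_pair :: "('a ell2 \<Rightarrow> 'a ell2) \<Rightarrow> ('a ell2 \<Rightarrow> 'a ell2) \<Rightarrow> bool" where
  "commuting_pair S1 S2 \<longleftrightarrow>
     bounded_operator S1 \<and> bounded_operator S2 \<and> S1 \<circ> S2 = S2 \<circ> S1"

definition spherically_quasinormal :: "('a ell2 \<Rightarrow> 'a ell2) \<Rightarrow> ('a ell2 \<Rightarrow> 'a ell2) \<Rightarrow> bool" where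
  "spherically_quasinormal S1 S2 \<longleftrightarrow> commuting_pair S1 S2 \<and>
     (let Q = (\<lambda>x. cadjoint S1 (S1 x) + cadjoint S2 (S2 x))
      in S1 \<circ> Q = Q \<circ> S1 \<and> S2 \<circ> Q = Q \<circ> S2)"

definition jointly_quasinormal :: "('a ell2 \<Rightarrow> 'a ell2) \<Rightarrow> ('a ell2 \<Rightarrow> 'a ell2) \<Rightarrow> bool" where
  "jointly_quasinormal S1 S2 \<longleftrightarrow> commuting_pair S1 S2 \<and>
     (\<forall>S\<in>{S1, S2}. \<forall>R\<in>{S1, S2}. S \<circ> (cadjoint R \<circ> R) = (cadjoint R \<circ> R) \<circ> S)"


section \<open>Commuting 2-variable weighted shifts\<close>

text \<open>
  A bounded operator is determined by its values on the canonical basis, so the weights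
  determine the pair \<open>(T1, T2)\<close>.
\<close>

definition weighted_shift2 ::
  "(nat \<times> nat \<Rightarrow> real) \<Rightarrow> (nat \<times> nat \<Rightarrow> real) \<Rightarrow>
   ((nat \<times> nat) ell2 \<Rightarrow> (nat \<times> nat) ell2) \<Rightarrow> ((nat \<times> nat) ell2 \<Rightarrow> (nat \<times> nat) ell2) \<Rightarrow> bool"
  where
  "weighted_shift2 \<alpha> \<beta> T1 T2 \<longleftrightarrow>
     (\<forall>k. 0 < \<alpha> k) \<and> (\<forall>k. 0 < \<beta> k) \<and> bounded (range \<alpha>) \<and> bounded (range \<beta>) \<and>
     bounded_operator T1 \<and> bounded_operator T2 \<and>
     (\<forall>k. T1 (basis_vec k) = scaleC (complex_of_real (\<alpha> k)) (basis_vec (k + (1, 0)))) \<and>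
     (\<forall>k. T2 (basis_vec k) = scaleC (complex_of_real (\<beta> k)) (basis_vec (k + (0, 1)))) \<and>
     T1 \<circ> T2 = T2 \<circ> T1"

end

(*
  Put x_k = (alpha_k)^2 and y_k = (beta_k)^2.  A pair of shifts is spherically quasinormal as soon
  as its squared weights have constant sum, and it is quasinormal only if the squared weights of
  T1 are constant along the first direction.  With x + y = 1 and commutativity, asking that
  x_k x_(k+e1) + y_k and x_k + y_k y_(k+e2) be equal to 1 - p leads to x_(k+e1) = phi(x_k) and
  x_k = phi(x_(k+e2)) for the Moebius map phi(t) = 1 - p/t.  For 0 < p < 1/4 this map has two
  fixed points in (0,1) and the interval between them is invariant under phi and its inverse, so
  any starting point strictly between them gives non-constant admissible weights.  For p = 2/9 the
  fixed points are 1/3 and 2/3, and x_(0,0) = 1/2 yields the closed form used here.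
*)
theory Submission
  imports Defs
begin

section \<open>Weighted operators along an injection of the index set, their boundedness and
  adjoints\<close>

lemma ell2_eqI: "(\<And>k. coord x k = coord y k) \<Longrightarrow> x = y"
  by (metis coord_inject ext)

text \<open>For injective \<open>s\<close> this is the coordinate form of the operator taking
  \<open>basis_vec k\<close> to \<open>w k\<close> times \<open>basis_vec (s k)\<close>. A general
  map in place of a translation lets the same lemmas serve both shifts and their squares.\<close>

definition weighted_pushforward :: "('a \<Rightarrow> real) \<Rightarrow> ('a \<Rightarrow> 'a) \<Rightarrow> ('a \<Rightarrow> complex) \<Rightarrow> 'a \<Rightarrow> complex" where
  "weighted_pushforward w s f j =
     (if j \<in> range s then complex_of_real (w (inv s j)) * f (inv s j) else 0)"

text \<open>\<open>Abs_ell2\<close> is meaningful only on square-summable families; bounded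
  \<open>w\<close> and injective \<open>s\<close>, fixed in the context below, ensure this.\<close>

definition weighted_op :: "('a \<Rightarrow> real) \<Rightarrow> ('a \<Rightarrow> 'a) \<Rightarrow> 'a ell2 \<Rightarrow> 'a ell2" where
  "weighted_op w s x = Abs_ell2 (weighted_pushforward w s (coord x))"

lemma square_weight_bound:
  assumes "\<And>k. \<bar>w k\<bar> \<le> B"
  shows "(cmod (complex_of_real (w k) * z))\<^sup>2 \<le> B\<^sup>2 * (cmod z)\<^sup>2"
proof -
  have "\<bar>w k\<bar>\<^sup>2 \<le> B\<^sup>2"
    by (rule power_mono) (use assms in auto)
  then show ?thesis
    by (simp add: norm_mult power_mult_distrib mult_right_mono)
qed

lemma square_summable_weighted:
  fixes f :: "'a \<Rightarrow> complex"
  assumes "bounded (range w)" "(\<lambda>k. (cmod (f k))\<^sup>2) summable_on UNIV"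
  shows "(\<lambda>k. (cmod (complex_of_real (w k) * f k))\<^sup>2) summable_on UNIV"
proof -
  obtain B where B: "\<And>k. \<bar>w k\<bar> \<le> B"
    using assms(1) by (auto simp: bounded_iff)
  show ?thesis
    by (rule summable_on_comparison_test[OF summable_on_cmult_right[OF assms(2), of "B\<^sup>2"]])
      (auto intro: square_weight_bound B)
qed

text \<open>The form with \<open>has_sum\<close> transfers convergence and value at once, which
  serves the norm bound as well as the adjoint.\<close>

lemma has_sum_range_iff:
  fixes g :: "'a \<Rightarrow> 'b :: topological_comm_monoid_add"
  assumes "inj s" "\<And>j. j \<notin> range s \<Longrightarrow> g j = 0"
  shows "(g has_sum S) UNIV \<longleftrightarrow> ((\<lambda>k. g (s k)) has_sum S) UNIV"
proof -
  have "(g has_sum S) UNIV \<longleftrightarrow> (g has_sum S) (range s)"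
    by (rule has_sum_cong_neutral) (use assms(2) in auto)
  also have "\<dots> \<longleftrightarrow> ((g \<circ> s) has_sum S) UNIV"
    by (rule has_sum_reindex[OF assms(1)])
  finally show ?thesis by (simp add: o_def)
qed

lemma weighted_pushforward_at_image [simp]:
  "inj s \<Longrightarrow> weighted_pushforward w s f (s k) = complex_of_real (w k) * f k"
  by (simp add: weighted_pushforward_def)

lemma weighted_pushforward_outside [simp]:
  "j \<notin> range s \<Longrightarrow> weighted_pushforward w s f j = 0"
  by (simp add: weighted_pushforward_def)

context
  fixes w :: "'a \<Rightarrow> real" and s :: "'a \<Rightarrow> 'a"
  assumes bounded_w: "bounded (range w)" and inj_s: "inj s"
begin

lemma coord_weighted_op: "coord (weighted_op w s x) = weighted_pushforward w s (coord x)"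
proof -
  obtain S where "((\<lambda>k. (cmod (complex_of_real (w k) * coord x k))\<^sup>2) has_sum S) UNIV"
    using square_summable_weighted[OF bounded_w summable_coord] by (auto simp: summable_on_def)
  then have "((\<lambda>j. (cmod (weighted_pushforward w s (coord x) j))\<^sup>2) has_sum S) UNIV"
    by (subst has_sum_range_iff[OF inj_s]) (simp_all add: inj_s)
  then show ?thesis
    unfolding weighted_op_def by (subst Abs_ell2_inverse) (auto simp: summable_on_def)
qed

lemma weighted_op_add: "weighted_op w s (x + y) = weighted_op w s x + weighted_op w s y"
  by (rule ell2_eqI)
    (simp add: coord_weighted_op plus_ell2.rep_eq weighted_pushforward_def ring_distribs)

lemma weighted_op_scaleC: "weighted_op w s (scaleC c x) = scaleC c (weighted_op w s x)"
  by (rule ell2_eqI) (simp add: coord_weighted_op scaleC.rep_eq weighted_pushforward_def)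

lemma bounded_operator_weighted_op: "bounded_operator (weighted_op w s)"
proof -
  obtain B where B: "\<And>k. \<bar>w k\<bar> \<le> B"
    using bounded_w by (auto simp: bounded_iff)
  \<comment> \<open>Any point of the nonempty index type gives 0 \<le> |w| \<le> B.\<close>
  have "B \<ge> 0" using B[of undefined] by linarith
  have norm_le: "norm (weighted_op w s x) \<le> norm x * B" for x
  proof -
    have sm: "((\<lambda>k. (cmod (complex_of_real (w k) * coord x k))\<^sup>2) summable_on UNIV)"
      by (rule square_summable_weighted[OF bounded_w summable_coord])
    have "((\<lambda>j. (cmod (weighted_pushforward w s (coord x) j))\<^sup>2) has_sum
        (\<Sum>\<^sub>\<infinity>k. (cmod (complex_of_real (w k) * coord x k))\<^sup>2)) UNIV"
      by (subst has_sum_range_iff[OF inj_s]) (use sm in \<open>simp_all add: inj_s\<close>)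
    then have "(\<Sum>\<^sub>\<infinity>j. (cmod (weighted_pushforward w s (coord x) j))\<^sup>2)
        = (\<Sum>\<^sub>\<infinity>k. (cmod (complex_of_real (w k) * coord x k))\<^sup>2)"
      by (rule infsumI)
    also have "\<dots> \<le> (\<Sum>\<^sub>\<infinity>k. B\<^sup>2 * (cmod (coord x k))\<^sup>2)"
      by (intro infsum_mono sm summable_on_cmult_right summable_coord square_weight_bound B)
    also have "\<dots> = B\<^sup>2 * (\<Sum>\<^sub>\<infinity>k. (cmod (coord x k))\<^sup>2)"
      by (rule infsum_cmult_right')
    finally have "(norm (weighted_op w s x))\<^sup>2 \<le> B\<^sup>2 * (norm x)\<^sup>2"
      by (simp add: norm_ell2_def coord_weighted_op infsum_nonneg)
    then have "(norm (weighted_op w s x))\<^sup>2 \<le> (norm x * B)\<^sup>2"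
      by (simp add: power_mult_distrib mult.commute)
    then show ?thesis
      by (rule power2_le_imp_le) (simp add: \<open>B \<ge> 0\<close>)
  qed
  have "bounded_linear (weighted_op w s)"
    by (rule bounded_linear_intro[OF weighted_op_add _ norm_le])
      (simp add: scaleR_ell2_def weighted_op_scaleC)
  then show ?thesis
    by (simp add: bounded_operator_def weighted_op_scaleC)
qed

lemma weighted_op_basis_vec:
  "weighted_op w s (basis_vec k) = scaleC (complex_of_real (w k)) (basis_vec (s k))"
proof (rule ell2_eqI)
  fix j
  show "coord (weighted_op w s (basis_vec k)) j
      = coord (scaleC (complex_of_real (w k)) (basis_vec (s k))) j"
    by (cases "j \<in> range s")
      (auto simp: coord_weighted_op scaleC.rep_eq basis_vec.rep_eq inj_s inj_eq)
qed

text \<open>Pairing with a pushforward along \<open>s\<close> is pairing with a pullback along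
  \<open>s\<close>; the weights are real, so no conjugate falls on them.\<close>

lemma cadjoint_weighted_op:
  "coord (cadjoint (weighted_op w s) y) k = complex_of_real (w k) * coord y (s k)"
proof -
  define adj where "adj y = Abs_ell2 (\<lambda>k. complex_of_real (w k) * coord y (s k))" for y :: "'a ell2"
  have adj: "coord (adj y) = (\<lambda>k. complex_of_real (w k) * coord y (s k))" for y
  proof -
    \<comment> \<open>Up to weights, the pullback is a reindexed subfamily of a square-summable
      family.\<close>
    have "(\<lambda>j. (cmod (coord y j))\<^sup>2) summable_on range s"
      by (rule summable_on_subset_banach[OF summable_coord]) simp
    then have "(\<lambda>k. (cmod (coord y (s k)))\<^sup>2) summable_on UNIV"
      by (simp add: summable_on_reindex[OF inj_s] o_def)
    then show ?thesis
      unfolding adj_def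
      by (subst Abs_ell2_inverse) (simp_all add: square_summable_weighted[OF bounded_w])
  qed
  have "cadjoint (weighted_op w s) = adj"
  proof (rule cadjoint_eqI)
    fix x y
    have "(\<lambda>k. coord x k * cnj (coord (adj y) k)) summable_on UNIV"
      by (rule square_summable_mult_cnj[OF summable_coord summable_coord])
    then have "((\<lambda>k. coord x k * cnj (coord (adj y) k)) has_sum cinner x (adj y)) UNIV"
      by (simp add: cinner_def)
    then have "((\<lambda>j. weighted_pushforward w s (coord x) j * cnj (coord y j)) has_sum
        cinner x (adj y)) UNIV"
      by (subst has_sum_range_iff[OF inj_s]) (simp_all add: inj_s adj mult_ac)
    then show "cinner (weighted_op w s x) y = cinner x (adj y)"
      unfolding cinner_def[of "weighted_op w s x"] coord_weighted_op by (rule infsumI)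
  qed
  then show ?thesis by (simp add: adj)
qed

text \<open>Diagonality turns both kinds of quasinormality into conditions on squared
  weights.\<close>

lemma cadjoint_weighted_op_self:
  "coord (cadjoint (weighted_op w s) (weighted_op w s x)) k = complex_of_real ((w k)\<^sup>2) * coord x k"
  by (simp add: cadjoint_weighted_op coord_weighted_op inj_s power2_eq_square)

end

section \<open>Compositions, commutation and quasinormality in terms of weights\<close>

lemma bounded_range_mult_compose:
  fixes w v :: "'a \<Rightarrow> real"
  assumes "bounded (range w)" "bounded (range v)"
  shows "bounded (range (\<lambda>k. w (t k) * v k))"
proof -
  obtain A B where "\<And>k. \<bar>w k\<bar> \<le> A" "\<And>k. \<bar>v k\<bar> \<le> B"
    using assms by (auto simp: bounded_iff)
  then have "norm (w (t k) * v k) \<le> A * B" for k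
    unfolding real_norm_def abs_mult by (intro mult_mono') auto
  then show ?thesis by (auto simp: bounded_iff)
qed

lemma weighted_op_comp:
  assumes "bounded (range w)" "inj s" "bounded (range v)" "inj t"
  shows "weighted_op w s \<circ> weighted_op v t = weighted_op (\<lambda>k. w (t k) * v k) (s \<circ> t)"
proof (intro ext ell2_eqI)
  fix x j
  have bd: "bounded (range (\<lambda>k. w (t k) * v k))"
    by (rule bounded_range_mult_compose[OF assms(1,3)])
  have inj: "inj (s \<circ> t)" by (rule inj_compose[OF assms(2,4)])
  note [simp] = coord_weighted_op[OF assms(1,2)] coord_weighted_op[OF assms(3,4)]
    coord_weighted_op[OF bd inj] assms(2,4)
  \<comment> \<open>In the second case the left side vanishes because the inner image is zero at
    \<open>i\<close>, the right side because injectivity of \<open>s\<close> keeps \<open>j\<close>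
    out of \<open>range (s \<circ> t)\<close>.\<close>
  consider k where "j = s (t k)" | i where "j = s i" "i \<notin> range t" | "j \<notin> range s"
    by blast
  then show "coord ((weighted_op w s \<circ> weighted_op v t) x) j
      = coord (weighted_op (\<lambda>k. w (t k) * v k) (s \<circ> t) x) j"
  proof cases
    case 1
    then show ?thesis
      using weighted_pushforward_at_image[OF inj, of "\<lambda>k. w (t k) * v k" "coord x" k]
      by simp
  next
    case 2
    then have "j \<notin> range (s \<circ> t)" by (auto simp: inj_eq[OF assms(2)])
    with 2 show ?thesis by simp
  next
    case 3
    then have "j \<notin> range (s \<circ> t)" by auto
    with 3 show ?thesis by simp
  qed
qed

lemma weighted_op_commute:
  assumes "bounded (range w)" "inj s" "bounded (range v)" "inj t"
    and "s \<circ> t = t \<circ> s" "\<And>k. w (t k) * v k = v (s k) * w k"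
  shows "weighted_op w s \<circ> weighted_op v t = weighted_op v t \<circ> weighted_op w s"
  using assms by (simp add: weighted_op_comp)

text \<open>The sum of the two diagonal operators is the scalar \<open>c\<close>, which commutes
  with every complex-linear operator.\<close>

lemma spherically_quasinormal_weighted_op:
  assumes "bounded (range w)" "inj s" "bounded (range v)" "inj t"
    and commute: "weighted_op w s \<circ> weighted_op v t = weighted_op v t \<circ> weighted_op w s"
    and const: "\<And>k. (w k)\<^sup>2 + (v k)\<^sup>2 = c"
  shows "spherically_quasinormal (weighted_op w s) (weighted_op v t)"
proof -
  have "(\<lambda>x. cadjoint (weighted_op w s) (weighted_op w s x)
        + cadjoint (weighted_op v t) (weighted_op v t x)) = scaleC (complex_of_real c)"
    by (intro ext ell2_eqI)
      (simp add: plus_ell2.rep_eq scaleC.rep_eq cadjoint_weighted_op_self assms(1-4) const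
        flip: distrib_right of_real_add of_real_power)
  then show ?thesis
    using assms(1-4) commute
    by (simp add: spherically_quasinormal_def commuting_pair_def bounded_operator_weighted_op
        weighted_op_scaleC fun_eq_iff)
qed

text \<open>Take both operators in the definition to be the first one, apply them to
  \<open>basis_vec k\<close> and read coordinate \<open>s k\<close>: the cube of \<open>w k\<close>
  equals \<open>w k\<close> times the square of \<open>w (s k)\<close>, and the nonzero factor
  cancels.\<close>

lemma jointly_quasinormal_weight_eq:
  assumes "bounded (range w)" "inj s" "w k \<noteq> 0"
    and "jointly_quasinormal (weighted_op w s) S2"
  shows "(w (s k))\<^sup>2 = (w k)\<^sup>2"
proof -
  let ?S = "weighted_op w s"
  have "?S (cadjoint ?S (?S (basis_vec k))) = cadjoint ?S (?S (?S (basis_vec k)))"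
    using assms(4) by (simp add: jointly_quasinormal_def fun_eq_iff)
  then have "coord (?S (cadjoint ?S (?S (basis_vec k)))) (s k)
      = coord (cadjoint ?S (?S (?S (basis_vec k)))) (s k)"
    by simp
  then have "complex_of_real (w k) * complex_of_real ((w k)\<^sup>2)
      = complex_of_real ((w (s k))\<^sup>2) * complex_of_real (w k)"
    by (simp add: coord_weighted_op cadjoint_weighted_op_self assms(1,2) basis_vec.rep_eq
        del: of_real_power)
  then have "w k * (w k)\<^sup>2 = (w (s k))\<^sup>2 * w k"
    by (metis of_real_eq_iff of_real_mult)
  then show ?thesis using assms(3) by simp
qed

section \<open>The explicit weights and their identities\<close>

definition moebius_weight :: "nat \<Rightarrow> nat \<Rightarrow> real" where
  "moebius_weight m n = sqrt ((2 * 2 ^ m + 2 ^ n) / (3 * (2 ^ m + 2 ^ n)))"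

lemma moebius_weight_pos: "0 < moebius_weight m n"
  by (simp add: moebius_weight_def add_pos_pos)

text \<open>This is the average of the fixed points 2/3 and 1/3 with masses 2^m and 2^n. Raising m
  by one applies phi; exchanging m and n gives the complement to 1, so \<beta> can be \<alpha> with
  its arguments exchanged.\<close>

lemma moebius_weight_square:
  "(moebius_weight m n)\<^sup>2 = (2 * 2 ^ m + 2 ^ n) / (3 * (2 ^ m + 2 ^ n))"
  by (simp add: moebius_weight_def)

text \<open>Each numerator cancels the other denominator up to a constant, leaving p = 2/9 for the
  squares.\<close>

lemma moebius_weight_mult: "moebius_weight m (Suc n) * moebius_weight n m = sqrt (2 / 9)"
proof -
  define a b :: real where "a = 2 ^ m" and "b = 2 ^ n"
  have "a > 0" "b > 0" by (simp_all add: a_def b_def)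
  then have "a + b \<noteq> 0" "a + 2 * b \<noteq> 0" by auto
  then have "(2 * a + 2 * b) / (3 * (a + 2 * b)) * ((2 * b + a) / (3 * (b + a))) = 2 / 9"
    by (simp add: divide_simps) (simp add: algebra_simps)
  then show ?thesis
    unfolding moebius_weight_def power_Suc a_def[symmetric] b_def[symmetric]
    by (metis real_sqrt_mult)
qed

lemma moebius_weight_sum: "(moebius_weight m n)\<^sup>2 + (moebius_weight n m)\<^sup>2 = 1"
proof -
  define a b :: real where "a = 2 ^ m" and "b = 2 ^ n"
  have "a > 0" "b > 0" by (simp_all add: a_def b_def)
  then have "a + b \<noteq> 0" "b + a \<noteq> 0" by auto
  then show ?thesis
    unfolding moebius_weight_square a_def[symmetric] b_def[symmetric]
    by (simp add: divide_simps) (simp add: algebra_simps)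
qed

lemma moebius_weight_le_1: "moebius_weight m n \<le> 1"
proof (rule power2_le_imp_le)
  show "(moebius_weight m n)\<^sup>2 \<le> 1\<^sup>2"
    using moebius_weight_sum[of m n] zero_le_power2[of "moebius_weight n m"]
    unfolding one_power2 by linarith
qed simp

text \<open>With x and y the squares of \<open>moebius_weight m n\<close> and
  \<open>moebius_weight n (Suc m)\<close>, the left side is (1 - y) x + (1 - x) = 1 - x y, and x y =
  2/9.\<close>

lemma moebius_weight_square_sum:
  "(moebius_weight (Suc m) n * moebius_weight m n)\<^sup>2 + (moebius_weight n m)\<^sup>2 = 7 / 9"
proof -
  have "(moebius_weight n (Suc m))\<^sup>2 * (moebius_weight m n)\<^sup>2 = 2 / 9"
    by (simp add: moebius_weight_mult flip: power_mult_distrib)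
  moreover have "(moebius_weight (Suc m) n)\<^sup>2 = 1 - (moebius_weight n (Suc m))\<^sup>2"
    "(moebius_weight n m)\<^sup>2 = 1 - (moebius_weight m n)\<^sup>2"
    using moebius_weight_sum[of "Suc m" n] moebius_weight_sum[of n m] by linarith+
  ultimately show ?thesis
    by (simp add: power_mult_distrib left_diff_distrib)
qed

theorem mainTheorem4:
  shows "\<exists>\<alpha> \<beta> T1 T2. weighted_shift2 \<alpha> \<beta> T1 T2 \<and>
           spherically_quasinormal T1 T2 \<and>
           spherically_quasinormal (T1 ^^ 2) T2 \<and>
           spherically_quasinormal T1 (T2 ^^ 2) \<and>
           \<not> jointly_quasinormal T1 T2"
proof -
  define \<alpha> \<beta> :: "nat \<times> nat \<Rightarrow> real"
    where "\<alpha> k = moebius_weight (fst k) (snd k)" and "\<beta> k = moebius_weight (snd k) (fst k)" for k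
  define s t :: "nat \<times> nat \<Rightarrow> nat \<times> nat" where "s k = k + (1, 0)" and "t k = k + (0, 1)" for k
  define T1 T2 where "T1 = weighted_op \<alpha> s" and "T2 = weighted_op \<beta> t"
  have pos: "0 < \<alpha> k" "0 < \<beta> k" for k
    by (simp_all add: \<alpha>_def \<beta>_def moebius_weight_pos)
  have bd: "bounded (range \<alpha>)" "bounded (range \<beta>)"
    by (auto simp: \<alpha>_def \<beta>_def bounded_iff abs_of_pos moebius_weight_pos intro!: exI[of _ 1]
        moebius_weight_le_1)
  have inj: "inj s" "inj t"
    by (auto simp: s_def t_def inj_def)
  have bd2: "bounded (range (\<lambda>k. \<alpha> (s k) * \<alpha> k))" "bounded (range (\<lambda>k. \<beta> (t k) * \<beta> k))"
    by (intro bounded_range_mult_compose bd)+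
  have T1_T1: "T1 ^^ 2 = weighted_op (\<lambda>k. \<alpha> (s k) * \<alpha> k) (s \<circ> s)"
    and T2_T2: "T2 ^^ 2 = weighted_op (\<lambda>k. \<beta> (t k) * \<beta> k) (t \<circ> t)"
    by (simp_all add: numeral_2_eq_2 T1_def T2_def weighted_op_comp bd inj)
  have commute: "T1 \<circ> T2 = T2 \<circ> T1"
    unfolding T1_def T2_def
  proof (rule weighted_op_commute[OF bd(1) inj(1) bd(2) inj(2)])
    show "s \<circ> t = t \<circ> s"
      by (simp add: fun_eq_iff s_def t_def add_ac)
    \<comment> \<open>Both sides are sqrt (2/9), by two instances of one identity with m and n
      exchanged.\<close>
    show "\<alpha> (t k) * \<beta> k = \<beta> (s k) * \<alpha> k" for k
      by (simp add: \<alpha>_def \<beta>_def s_def t_def moebius_weight_mult)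
  qed
  have commute2: "(T1 ^^ 2) \<circ> T2 = T2 \<circ> (T1 ^^ 2)" "T1 \<circ> (T2 ^^ 2) = (T2 ^^ 2) \<circ> T1"
    using commute by (simp_all add: numeral_2_eq_2 fun_eq_iff)
  have "weighted_shift2 \<alpha> \<beta> T1 T2"
    using pos bd inj commute
    by (simp add: weighted_shift2_def T1_def T2_def bounded_operator_weighted_op
        weighted_op_basis_vec) (simp add: s_def t_def)
  moreover have "spherically_quasinormal T1 T2"
    unfolding T1_def T2_def
    by (rule spherically_quasinormal_weighted_op[where c = 1])
      (use bd inj commute in \<open>simp_all add: T1_def T2_def \<alpha>_def \<beta>_def moebius_weight_sum\<close>)
  moreover have "spherically_quasinormal (T1 ^^ 2) T2"
    unfolding T1_T1 T2_def
  proof (rule spherically_quasinormal_weighted_op[OF bd2(1) inj_compose[OF inj(1,1)] bd(2) inj(2)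
        commute2(1)[unfolded T1_T1 T2_def]])
    show "(\<alpha> (s k) * \<alpha> k)\<^sup>2 + (\<beta> k)\<^sup>2 = 7 / 9" for k
      by (simp add: \<alpha>_def \<beta>_def s_def moebius_weight_square_sum)
  qed
  moreover have "spherically_quasinormal T1 (T2 ^^ 2)"
    unfolding T2_T2 T1_def
  proof (rule spherically_quasinormal_weighted_op[OF bd(1) inj(1) bd2(2) inj_compose[OF inj(2,2)]
        commute2(2)[unfolded T2_T2 T1_def]])
    show "(\<alpha> k)\<^sup>2 + (\<beta> (t k) * \<beta> k)\<^sup>2 = 7 / 9" for k
      \<comment> \<open>Exchanging the coordinates reduces this to the previous case, with the
        summands in the other order.\<close>
      by (subst add.commute) (simp add: \<alpha>_def \<beta>_def t_def moebius_weight_square_sum)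
  qed
  moreover have "\<not> jointly_quasinormal T1 T2"
  proof
    assume "jointly_quasinormal T1 T2"
    then have "(\<alpha> (s (0, 0)))\<^sup>2 = (\<alpha> (0, 0))\<^sup>2"
      unfolding T1_def using pos(1)[of "(0, 0)"]
      by (intro jointly_quasinormal_weight_eq bd inj) auto
    then show False
      \<comment> \<open>The squared weights are 5/9 at (1,0) and 1/2 at the origin.\<close>
      by (simp add: \<alpha>_def s_def moebius_weight_square)
  qed
  ultimately show ?thesis by blast
qed

end
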